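(* For every $q_{R,\mathbf r,p}$ spanning an extreme ray of $\mathcal N(F)$, the associated ternary octic $P_{R,\mathbf r,p}$ is a sum of squares of polynomials. Consequently, $\mathcal P=\Sigma$; that is, for all symmetric $R\in\mathbb R^{2\times2}$, $\mathbf r\in\mathbb R^2$, $p\in\mathbb R$, the form $P_{R,\mathbf r,p}$ is nonnegative on $\mathbb R^3$ if and only if it is a sum of squares of polynomials.
   Context: Let $F:=\{(x_1,x_2)\in\mathbb R^2 : x_1\ge 0,\ x_2\ge 0,\ x_1x_2\le 1\}$. For symmetric $R\in\mathbb R^{2\times 2}$, $\mathbf r=(r_1,r_2)\in\mathbb R^2$, $p\in\mathbb R$, let $q_{R,\mathbf r,p}(\mathbf x):=\mathbf x^\top R\mathbf x+2\mathbf r^\top\mathbf x+p$. $\mathcal N(F)$ is the convex cone of all $q_{R,\mathbf r,p}$ that are nonnegative on $F$. A nonzero $q\in\mathcal N(F)$ spans an extreme ray if whenever $q=q_1+q_2$ with $q_1,q_2\in\mathcal N(F)$, both $q_1,q_2$ are nonnegative multiples of $q$. The ternary octic form associated with $(R,\mathbf r,p)$ is $$P_{R,\mathbf r,p}(y_1,y_2,y_3):=\begin{pmatrix} A \\ B \\ C \end{pmatrix}^{\top}\begin{pmatrix} R_{11} & r_1 & R_{12} \\ r_1 & p & r_2 \\ R_{12} & r_2 & R_{22} \end{pmatrix}\begin{pmatrix} A \\ B \\ C \end{pmatrix},$$ where $A:=y_1^2(y_1^2+y_2^2)$, $B:=y_3^2(y_1^2+y_2^2)$, $C:=y_3^4$.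 Define $\mathcal P:=\{P_{R,\mathbf r,p} : P_{R,\mathbf r,p}\ge0\text{ on }\mathbb R^3\}$ and $\Sigma:=\{P_{R,\mathbf r,p} : P_{R,\mathbf r,p}\text{ is a sum of squares of polynomials in } \mathbb R[y_1,y_2,y_3]\}$, where $(R,\mathbf r,p)$ ranges over all symmetric $R\in\mathbb R^{2\times2}$, $\mathbf r\in\mathbb R^2$, $p\in\mathbb R$. *)

theory Defs
  imports "HOL-Analysis.Analysis" "HOL-Computational_Algebra.Polynomial"
begin

definition F :: "(real^2) set" where
  "F = {x. x$1 \<ge> 0 \<and> x$2 \<ge> 0 \<and> x$1 * x$2 \<le> 1}"

definition quad :: "real^2^2 \<Rightarrow> real^2 \<Rightarrow> real \<Rightarrow> real^2 \<Rightarrow> real" where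
  "quad R r p x = x \<bullet> (R *v x) + 2 * (r \<bullet> x) + p"

definition nonneg_cone :: "(real^2) set \<Rightarrow> (real^2 \<Rightarrow> real) set" where
  "nonneg_cone S = {quad R r p | R r p. transpose R = R \<and> (\<forall>x\<in>S. quad R r p x \<ge> 0)}"

definition spans_extreme_ray :: "(real^2 \<Rightarrow> real) set \<Rightarrow> (real^2 \<Rightarrow> real) \<Rightarrow> bool" where
  "spans_extreme_ray K q \<longleftrightarrow> q \<in> K \<and> q \<noteq> (\<lambda>x. 0) \<and>
     (\<forall>q1\<in>K. \<forall>q2\<in>K. q = (\<lambda>x. q1 x + q2 x) \<longrightarrow>
        (\<exists>c\<ge>0. q1 = (\<lambda>x. c * q x)) \<and> (\<exists>c\<ge>0. q2 = (\<lambda>x. c * q x)))"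

text \<open>The ring of real polynomials in three variables is represented as the iterated
  polynomial ring over the reals: the innermost variable is y1, the outermost is y3.\<close>

type_synonym poly3 = "real poly poly poly"

definition Const :: "real \<Rightarrow> poly3" where "Const c = [:[:[:c:]:]:]"
definition Y1 :: poly3 where "Y1 = [:[:[:0, 1:]:]:]"
definition Y2 :: poly3 where "Y2 = [:[:0, 1:]:]"
definition Y3 :: poly3 where "Y3 = [:0, 1:]"

definition eval3 :: "poly3 \<Rightarrow> real^3 \<Rightarrow> real" where
  "eval3 f y = poly (poly (poly f [:[:y$3:]:]) [:y$2:]) (y$1)"

definition nonneg3 :: "poly3 \<Rightarrow> bool" where
  "nonneg3 f \<longleftrightarrow> (\<forall>y. eval3 f y \<ge> 0)"

definition sos3 :: "poly3 \<Rightarrow> bool" where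
  "sos3 f \<longleftrightarrow> (\<exists>gs :: poly3 list. f = (\<Sum>g\<leftarrow>gs. g^2))"

text \<open>The coordinate order is (x1, 1, x2): the vector (A, B, C) below is proportional to it
  with x1 = y1^2 / y3^2 and x2 = y3^2 / (y1^2 + y2^2).\<close>

definition hom_matrix :: "real^2^2 \<Rightarrow> real^2 \<Rightarrow> real \<Rightarrow> real^3^3" where
  "hom_matrix R r p =
     vector [vector [R$1$1, r$1, R$1$2],
             vector [r$1,   p,   r$2],
             vector [R$1$2, r$2, R$2$2]]"

definition ABC :: "poly3^3" where
  "ABC = vector [Y1^2 * (Y1^2 + Y2^2), Y3^2 * (Y1^2 + Y2^2), Y3^4]"

definition octic :: "real^2^2 \<Rightarrow> real^2 \<Rightarrow> real \<Rightarrow> poly3" where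
  "octic R r p = (\<Sum>i\<in>UNIV. \<Sum>j\<in>UNIV. ABC$i * Const (hom_matrix R r p $ i $ j) * ABC$j)"

definition nonneg_octics :: "poly3 set" where
  "nonneg_octics = {octic R r p | R r p. transpose R = R \<and> nonneg3 (octic R r p)}"

definition sos_octics :: "poly3 set" where
  "sos_octics = {octic R r p | R r p. transpose R = R \<and> sos3 (octic R r p)}"

end

theory Submission
  imports Defs
begin

text \<open>
  With x = y1^2 / y3^2 and y = y3^2 / (y1^2 + y2^2) the octic is B^2 q(x, y), and (x, y) ranges over
  a dense subset of F; so the octic is nonnegative iff q is nonnegative on F. It then suffices to
  write such a q as a sum of squares weighted by 1, x, y, x y, 1 - x y, y (1 - x y) and
  x y (1 - x y), because B^2 times each weighted square is a sum of squares of quartics.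
  After adding a small multiple of 1 + x^2 + y^2, subtract from q the largest multiple of x y that
  keeps it nonnegative on F; the result vanishes at some (x0, y0) with x0, y0 > 0. If x0 y0 < 1,
  the result is convex. If x0 y0 = 1, the scaling (x / x0, x0 y) moves the zero to (1, 1), and an explicit
  weighted representation exists, according to where on the axes the quadratic would next vanish.
  The perturbation is removed by compactness of the set of admissible coefficients.
\<close>

section \<open>Weighted squares and explicit certificates\<close>

type_synonym quadruple = "real \<times> real \<times> real \<times> real"
type_synonym weights =
  "quadruple \<times> quadruple \<times> quadruple \<times> (real \<times> real) \<times> (real \<times> real) \<times> quadruple"

lemma weights_cases:
  obtains a0 a1 a2 a3 b0 b1 b2 b3 c0 c1 c2 c3 e0 e1 f0 f1 k1 k2 k3 k4 where
    "(w :: weights) = ((a0, a1, a2, a3), (b0, b1, b2, b3), (c0, c1, c2, c3),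
       (e0, e1), (f0, f1), (k1, k2, k3, k4))"
proof -
  obtain A B C E G K where w: "w = (A, B, C, E, G, K)" by (rule prod_cases6)
  obtain a0 a1 a2 a3 where A: "A = (a0, a1, a2, a3)" by (rule prod_cases4)
  obtain b0 b1 b2 b3 where B: "B = (b0, b1, b2, b3)" by (rule prod_cases4)
  obtain c0 c1 c2 c3 where C: "C = (c0, c1, c2, c3)" by (rule prod_cases4)
  obtain e0 e1 where E: "E = (e0, e1)" by (rule prod.exhaust)
  obtain f0 f1 where G: "G = (f0, f1)" by (rule prod.exhaust)
  obtain k1 k2 k3 k4 where K: "K = (k1, k2, k3, k4)" by (rule prod_cases4)
  show ?thesis by (rule that) (simp only: w A B C E G K)
qed

text \<open>The weights are nonnegative on the region, and the \<open>k\<close>s enter squared, so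
  every real 20-tuple is an admissible certificate. With this fixed finite shape, limits of
  certificates can be taken coefficientwise.\<close>

definition weighted_squares :: "weights \<Rightarrow> real \<Rightarrow> real \<Rightarrow> real" where
  "weighted_squares w x y =
    (case w of ((a0, a1, a2, a3), (b0, b1, b2, b3), (c0, c1, c2, c3),
       (e0, e1), (f0, f1), (k1, k2, k3, k4)) \<Rightarrow>
     (a0 + a1 * x + a2 * y + a3 * (x * y))\<^sup>2
   + (b0 + b1 * x + b2 * y + b3 * (x * y))\<^sup>2
   + (c0 + c1 * x + c2 * y + c3 * (x * y))\<^sup>2
   + x * (e0 + e1 * y)\<^sup>2 + y * (f0 + f1 * x)\<^sup>2
   + k1\<^sup>2 * (x * y * (1 - x * y)) + k2\<^sup>2 * (1 - x * y)
   + k3\<^sup>2 * (x * y) + k4\<^sup>2 * (y * (1 - x * y)))"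

definition certified :: "(real \<Rightarrow> real \<Rightarrow> real) \<Rightarrow> bool" where
  "certified q \<longleftrightarrow> (\<exists>w. \<forall>x y. q x y = weighted_squares w x y)"

lemma certifiedI:
  assumes "k1 \<ge> 0" "k2 \<ge> 0" "k3 \<ge> 0" "k4 \<ge> 0"
  assumes "\<And>x y. q x y =
     (a0 + a1 * x + a2 * y + a3 * (x * y))\<^sup>2
   + (b0 + b1 * x + b2 * y + b3 * (x * y))\<^sup>2
   + (c0 + c1 * x + c2 * y + c3 * (x * y))\<^sup>2
   + x * (e0 + e1 * y)\<^sup>2 + y * (f0 + f1 * x)\<^sup>2
   + k1 * (x * y * (1 - x * y)) + k2 * (1 - x * y)
   + k3 * (x * y) + k4 * (y * (1 - x * y))"
  shows "certified q"
  unfolding certified_def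
proof (intro exI allI)
  fix x y
  show "q x y = weighted_squares ((a0, a1, a2, a3), (b0, b1, b2, b3), (c0, c1, c2, c3),
       (e0, e1), (f0, f1), (sqrt k1, sqrt k2, sqrt k3, sqrt k4)) x y"
    using assms by (simp add: weighted_squares_def)
qed

text \<open>Completing the square; when \<open>\<alpha> = 0\<close> the discriminant condition
  already forces \<open>\<beta> = 0\<close>.\<close>

lemma binary_form_two_squares:
  fixes \<alpha> \<beta> \<gamma> :: real
  assumes "\<alpha> \<ge> 0" "\<gamma> \<ge> 0" "\<beta>\<^sup>2 \<le> \<alpha> * \<gamma>"
  obtains a b c where "\<And>u v. \<alpha> * u\<^sup>2 + 2 * \<beta> * (u * v) + \<gamma> * v\<^sup>2 = (a * u + b * v)\<^sup>2 + (c * v)\<^sup>2"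
proof (cases "\<alpha> = 0")
  case True
  then have "\<beta> = 0" using assms by simp
  with True assms show ?thesis by (intro that[of 0 0 "sqrt \<gamma>"]) (simp add: power_mult_distrib)
next
  case False
  then have a: "\<alpha> > 0" using assms by simp
  define s where "s = sqrt \<alpha>"
  have s: "s > 0" "\<alpha> = s\<^sup>2" using a by (auto simp: s_def)
  have g: "\<gamma> - (\<beta> / s)\<^sup>2 \<ge> 0" using assms s by (simp add: field_simps)
  show ?thesis
  proof (rule that[of s "\<beta> / s" "sqrt (\<gamma> - (\<beta> / s)\<^sup>2)"])
    fix u v
    have "(s * u + \<beta> / s * v)\<^sup>2 = \<alpha> * u\<^sup>2 + 2 * \<beta> * (u * v) + (\<beta> / s)\<^sup>2 * v\<^sup>2"
      using s by (simp add: power2_eq_square field_simps)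
    then show "\<alpha> * u\<^sup>2 + 2 * \<beta> * (u * v) + \<gamma> * v\<^sup>2
      = (s * u + \<beta> / s * v)\<^sup>2 + (sqrt (\<gamma> - (\<beta> / s)\<^sup>2) * v)\<^sup>2"
      using g by (simp add: power_mult_distrib algebra_simps)
  qed
qed

lemma certified_convex_at:
  fixes \<alpha> \<beta> \<gamma> x0 y0 :: real
  assumes "\<alpha> \<ge> 0" "\<gamma> \<ge> 0" "\<beta>\<^sup>2 \<le> \<alpha> * \<gamma>" "\<mu> \<ge> 0" "m \<ge> 0"
  shows "certified (\<lambda>x y. \<alpha> * (x - x0)\<^sup>2 + 2 * \<beta> * ((x - x0) * (y - y0)) + \<gamma> * (y - y0)\<^sup>2
           + \<mu> * (1 - x * y) + m * (x * y))"
proof -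
  obtain a b c where *:
    "\<And>u v. \<alpha> * u\<^sup>2 + 2 * \<beta> * (u * v) + \<gamma> * v\<^sup>2 = (a * u + b * v)\<^sup>2 + (c * v)\<^sup>2"
    using binary_form_two_squares[OF assms(1-3)] by blast
  show ?thesis
    unfolding *
    by (rule certifiedI[of 0 \<mu> m 0 _ "- a * x0 - b * y0" a b 0 "- c * y0" 0 c 0 0 0 0 0 0 0 0 0])
       (use assms in \<open>auto simp: power2_eq_square algebra_simps\<close>)
qed

text \<open>
  For the least admissible \<open>\<mu>\<close> the quadratic is affine in \<open>\<alpha> / b\<close> and \<open>\<gamma> / b\<close>, so it is an average
  of its values at the corners of the unit square:
  2 (x + y - 2 x y) = 2 x (1 - y)^2 + 2 y (1 - x y),
  x^2 + 2 y - 3 x y = (x - x y)^2 + 2 y (1 - x)^2 + x y (1 - x y),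
  y^2 + 2 x - 3 x y = (y - x y)^2 + 2 x (1 - y)^2 + x y (1 - x y), and (x - y)^2.
\<close>
lemma certified_saddle_at_origin:
  fixes \<alpha> \<gamma> b :: real
  assumes "0 \<le> \<alpha>" "\<alpha> \<le> b" "0 \<le> \<gamma>" "\<gamma> \<le> b" "b > 0" "\<mu> \<ge> 2 * b - \<alpha> - \<gamma>" "m \<ge> 0"
  shows "certified (\<lambda>x y. \<alpha> * (x - 1)\<^sup>2 - 2 * b * ((x - 1) * (y - 1)) + \<gamma> * (y - 1)\<^sup>2
           + \<mu> * (1 - x * y) + m * (x * y))"
proof -
  define s t where "s = \<alpha> / b" and "t = \<gamma> / b"
  have st: "0 \<le> s" "s \<le> 1" "0 \<le> t" "t \<le> 1" "\<alpha> = b * s" "\<gamma> = b * t"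
    using assms by (auto simp: s_def t_def)
  \<comment> \<open>Bilinear interpolation weights of \<open>(s, t)\<close> for the corners (0, 0),
    (1, 0), (0, 1), (1, 1), scaled by \<open>b\<close>.\<close>
  define w00 w10 w01 w11 where "w00 = b * ((1 - s) * (1 - t))" and "w10 = b * (s * (1 - t))"
    and "w01 = b * ((1 - s) * t)" and "w11 = b * (s * t)"
  have w: "w00 \<ge> 0" "w10 \<ge> 0" "w01 \<ge> 0" "w11 \<ge> 0"
    using st assms(5) by (auto simp: w00_def w10_def w01_def w11_def)
  have e: "\<alpha> = w10 + w11" "\<gamma> = w01 + w11" "b = w00 + w10 + w01 + w11"
    unfolding st(5,6) by (simp_all add: w00_def w10_def w01_def w11_def algebra_simps)
  define A B C E G where "A = sqrt w10" and "B = sqrt w01" and "C = sqrt w11"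
    and "E = sqrt (2 * w00 + 2 * w01)" and "G = sqrt (2 * w10)"
  have sq: "A * A = w10" "B * B = w01" "C * C = w11" "E * E = 2 * w00 + 2 * w01" "G * G = 2 * w10"
    using w by (simp_all add: A_def B_def C_def E_def G_def)
  show ?thesis
  proof (rule certifiedI[of "w10 + w01" "\<mu> - (2 * b - \<alpha> - \<gamma>)" m "2 * w00" _
        0 A 0 "- A" 0 0 B "- B" 0 C "- C" 0 E "- E" G "- G"])
    fix x y :: real
    have sx: "(0 + A * x + 0 * y + - A * (x * y))\<^sup>2 = w10 * (x - x * y)\<^sup>2"
      unfolding sq(1)[symmetric] by (simp add: power2_eq_square algebra_simps)
    have sy: "(0 + 0 * x + B * y + - B * (x * y))\<^sup>2 = w01 * (y - x * y)\<^sup>2"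
      unfolding sq(2)[symmetric] by (simp add: power2_eq_square algebra_simps)
    have sz: "(0 + C * x + - C * y + 0 * (x * y))\<^sup>2 = w11 * (x - y)\<^sup>2"
      unfolding sq(3)[symmetric] by (simp add: power2_eq_square algebra_simps)
    have se: "(E + - E * y)\<^sup>2 = (2 * w00 + 2 * w01) * (1 - y)\<^sup>2"
      unfolding sq(4)[symmetric] by (simp add: power2_eq_square algebra_simps)
    have sf: "(G + - G * x)\<^sup>2 = 2 * w10 * (1 - x)\<^sup>2"
      unfolding sq(5)[symmetric] by (simp add: power2_eq_square algebra_simps)
    show "\<alpha> * (x - 1)\<^sup>2 - 2 * b * ((x - 1) * (y - 1)) + \<gamma> * (y - 1)\<^sup>2
           + \<mu> * (1 - x * y) + m * (x * y)
      = (0 + A * x + 0 * y + - A * (x * y))\<^sup>2 + (0 + 0 * x + B * y + - B * (x * y))\<^sup>2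
      + (0 + C * x + - C * y + 0 * (x * y))\<^sup>2
      + x * (E + - E * y)\<^sup>2 + y * (G + - G * x)\<^sup>2
      + (w10 + w01) * (x * y * (1 - x * y)) + (\<mu> - (2 * b - \<alpha> - \<gamma>)) * (1 - x * y)
      + m * (x * y) + 2 * w00 * (y * (1 - x * y))"
      unfolding sx sy sz se sf unfolding e by (simp add: power2_eq_square algebra_simps)
  qed (use w assms in auto)
qed

text \<open>
  For \<open>\<alpha> = 1\<close>, \<open>\<gamma> = 0\<close>, \<open>\<mu> = b\<^sup>2\<close> this rests on the identity
  (x - 1)^2 - 2 b (x - 1) (y - 1) + b^2 (1 - x y)
    = (x - 1 + b (1 - x y))^2 + 2 b y (x - 1)^2 + b^2 x y (1 - x y);
  larger \<open>\<gamma>\<close> interpolate between it and the square of (x - 1) - b (y - 1).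
\<close>
lemma certified_saddle_on_x_axis:
  fixes \<alpha> \<gamma> b :: real
  assumes "0 < b" "b \<le> \<alpha>" "0 \<le> \<gamma>" "\<alpha> * \<gamma> \<le> b\<^sup>2" "\<mu> \<ge> b\<^sup>2 / \<alpha> - \<gamma>" "m \<ge> 0"
  shows "certified (\<lambda>x y. \<alpha> * (x - 1)\<^sup>2 - 2 * b * ((x - 1) * (y - 1)) + \<gamma> * (y - 1)\<^sup>2
           + \<mu> * (1 - x * y) + m * (x * y))"
proof -
  \<comment> \<open>Here \<open>w\<close> interpolates in \<open>\<gamma>\<close>:
    \<open>w = 0\<close> is \<open>\<gamma> = 0\<close>, and \<open>w = 1\<close> is
    \<open>\<gamma> = b^2 / \<alpha>\<close>, where the form is a perfect square. The identity is
    applied with \<open>c\<close> in place of \<open>b\<close>.\<close>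
  define c w where "c = b / \<alpha>" and "w = \<alpha> * \<gamma> / b\<^sup>2"
  define u v where "u = \<alpha> * w" and "v = \<alpha> * (1 - w)"
  have c: "0 \<le> c" using assms by (simp add: c_def)
  have "0 \<le> w" "w \<le> 1" using assms by (auto simp: w_def)
  then have uv: "u \<ge> 0" "v \<ge> 0" using assms by (auto simp: u_def v_def)
  have a: "\<alpha> > 0" using assms by simp
  have e: "\<alpha> = u + v" "b = (u + v) * c" "\<gamma> = u * c\<^sup>2"
    using a assms by (simp_all add: u_def v_def c_def w_def power2_eq_square algebra_simps)
  have ba: "b\<^sup>2 / \<alpha> = (u + v) * c\<^sup>2" using a e(1)
    by (simp add: c_def power2_eq_square)
  define A B E where "A = sqrt u" and "B = sqrt v" and "E = sqrt (2 * c * v)"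
  have sq: "A * A = u" "B * B = v" "E * E = 2 * c * v"
    using uv c by (simp_all add: A_def B_def E_def)
  show ?thesis
  proof (rule certifiedI[of "v * c\<^sup>2" "\<mu> - v * c\<^sup>2" m 0 _
        "- A + A * c" A "- A * c" 0 "- B + B * c" B 0 "- B * c" 0 0 0 0 0 0 E "- E"])
    fix x y :: real
    have sx: "(- A + A * c + A * x + - A * c * y + 0 * (x * y))\<^sup>2 = u * ((x - 1) - c * (y - 1))\<^sup>2"
      unfolding sq(1)[symmetric] by (simp add: power2_eq_square algebra_simps)
    have sy: "(- B + B * c + B * x + 0 * y + - B * c * (x * y))\<^sup>2 = v * ((x - 1) + c * (1 - x * y))\<^sup>2"
      unfolding sq(2)[symmetric] by (simp add: power2_eq_square algebra_simps)
    have sf: "(E + - E * x)\<^sup>2 = 2 * c * v * (1 - x)\<^sup>2"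
      unfolding sq(3)[symmetric] by (simp add: power2_eq_square algebra_simps)
    show "\<alpha> * (x - 1)\<^sup>2 - 2 * b * ((x - 1) * (y - 1)) + \<gamma> * (y - 1)\<^sup>2
           + \<mu> * (1 - x * y) + m * (x * y)
      = (- A + A * c + A * x + - A * c * y + 0 * (x * y))\<^sup>2
      + (- B + B * c + B * x + 0 * y + - B * c * (x * y))\<^sup>2
      + (0 + 0 * x + 0 * y + 0 * (x * y))\<^sup>2
      + x * (0 + 0 * y)\<^sup>2 + y * (E + - E * x)\<^sup>2
      + v * c\<^sup>2 * (x * y * (1 - x * y)) + (\<mu> - v * c\<^sup>2) * (1 - x * y)
      + m * (x * y) + 0 * (y * (1 - x * y))"
      unfolding sx sy sf unfolding e by (simp add: power2_eq_square algebra_simps)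
  next
    show "\<mu> - v * c\<^sup>2 \<ge> 0" using assms(5) unfolding ba e(3) by (simp add: algebra_simps)
  qed (use uv c assms in auto)
qed

text \<open>The mirror image of the previous case, resting on (y - 1)^2 - 2 b (x - 1) (y - 1) + b^2
  (1 - x y) = (y - 1 + b (1 - x y))^2 + 2 b x (y - 1)^2 + b^2 x y (1 - x y).\<close>

lemma certified_saddle_on_y_axis:
  fixes \<alpha> \<gamma> b :: real
  assumes "0 < b" "b \<le> \<gamma>" "0 \<le> \<alpha>" "\<alpha> * \<gamma> \<le> b\<^sup>2" "\<mu> \<ge> b\<^sup>2 / \<gamma> - \<alpha>" "m \<ge> 0"
  shows "certified (\<lambda>x y. \<alpha> * (x - 1)\<^sup>2 - 2 * b * ((x - 1) * (y - 1)) + \<gamma> * (y - 1)\<^sup>2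
           + \<mu> * (1 - x * y) + m * (x * y))"
proof -
  define c w where "c = b / \<gamma>" and "w = \<alpha> * \<gamma> / b\<^sup>2"
  define u v where "u = \<gamma> * w" and "v = \<gamma> * (1 - w)"
  have c: "0 \<le> c" using assms by (simp add: c_def)
  have "0 \<le> w" "w \<le> 1" using assms by (auto simp: w_def)
  then have uv: "u \<ge> 0" "v \<ge> 0" using assms by (auto simp: u_def v_def)
  have a: "\<gamma> > 0" using assms by simp
  have e: "\<gamma> = u + v" "b = (u + v) * c" "\<alpha> = u * c\<^sup>2"
    using a assms by (simp_all add: u_def v_def c_def w_def power2_eq_square algebra_simps)
  have ba: "b\<^sup>2 / \<gamma> = (u + v) * c\<^sup>2" using a e(1)
    by (simp add: c_def power2_eq_square)
  define A B E where "A = sqrt u" and "B = sqrt v" and "E = sqrt (2 * c * v)"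
  have sq: "A * A = u" "B * B = v" "E * E = 2 * c * v"
    using uv c by (simp_all add: A_def B_def E_def)
  show ?thesis
  proof (rule certifiedI[of "v * c\<^sup>2" "\<mu> - v * c\<^sup>2" m 0 _
        "- A + A * c" "- A * c" A 0 "- B + B * c" 0 B "- B * c" 0 0 0 0 E "- E" 0 0])
    fix x y :: real
    have sx: "(- A + A * c + - A * c * x + A * y + 0 * (x * y))\<^sup>2 = u * ((y - 1) - c * (x - 1))\<^sup>2"
      unfolding sq(1)[symmetric] by (simp add: power2_eq_square algebra_simps)
    have sy: "(- B + B * c + 0 * x + B * y + - B * c * (x * y))\<^sup>2 = v * ((y - 1) + c * (1 - x * y))\<^sup>2"
      unfolding sq(2)[symmetric] by (simp add: power2_eq_square algebra_simps)
    have sf: "(E + - E * y)\<^sup>2 = 2 * c * v * (1 - y)\<^sup>2"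
      unfolding sq(3)[symmetric] by (simp add: power2_eq_square algebra_simps)
    show "\<alpha> * (x - 1)\<^sup>2 - 2 * b * ((x - 1) * (y - 1)) + \<gamma> * (y - 1)\<^sup>2
           + \<mu> * (1 - x * y) + m * (x * y)
      = (- A + A * c + - A * c * x + A * y + 0 * (x * y))\<^sup>2
      + (- B + B * c + 0 * x + B * y + - B * c * (x * y))\<^sup>2
      + (0 + 0 * x + 0 * y + 0 * (x * y))\<^sup>2
      + x * (E + - E * y)\<^sup>2 + y * (0 + 0 * x)\<^sup>2
      + v * c\<^sup>2 * (x * y * (1 - x * y)) + (\<mu> - v * c\<^sup>2) * (1 - x * y)
      + m * (x * y) + 0 * (y * (1 - x * y))"
      unfolding sx sy sf unfolding e by (simp add: power2_eq_square algebra_simps)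
  next
    show "\<mu> - v * c\<^sup>2 \<ge> 0" using assms(5) unfolding ba e(3) by (simp add: algebra_simps)
  qed (use uv c assms in auto)
qed

text \<open>The substitution preserves x y, so only the weights x, y and y (1 - x y) change, by
  positive factors that the coefficients absorb.\<close>

lemma certified_scale:
  assumes "certified Q" "t > 0"
  shows "certified (\<lambda>x y. Q (x / t) (t * y))"
proof -
  obtain w where w: "\<And>x y. Q x y = weighted_squares w x y"
    using assms(1) unfolding certified_def by blast
  obtain a0 a1 a2 a3 b0 b1 b2 b3 c0 c1 c2 c3 e0 e1 f0 f1 k1 k2 k3 k4 where
    "w = ((a0, a1, a2, a3), (b0, b1, b2, b3), (c0, c1, c2, c3),
       (e0, e1), (f0, f1), (k1, k2, k3, k4))"
    by (rule weights_cases)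
  note Q = w[unfolded this]
  define s where "s = sqrt t"
  have s: "s > 0" "t = s * s" using assms(2) by (auto simp: s_def)
  show ?thesis
  proof (rule certifiedI[of "k1\<^sup>2" "k2\<^sup>2" "k3\<^sup>2" "t * k4\<^sup>2" _ a0 "a1 / t" "a2 * t" a3
       b0 "b1 / t" "b2 * t" b3 c0 "c1 / t" "c2 * t" c3 "e0 / s" "e1 * s" "f0 * s" "f1 / s"])
    fix x y :: real
    have xy: "x / t * (t * y) = x * y" using assms(2) by simp
    have 1: "x / t * (e0 + e1 * (t * y))\<^sup>2 = x * (e0 / s + e1 * s * y)\<^sup>2"
      using s(1) unfolding s(2) by (simp add: power2_eq_square field_simps)
    have 2: "t * y * (f0 + f1 * (x / t))\<^sup>2 = y * (f0 * s + f1 / s * x)\<^sup>2"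
      using s(1) unfolding s(2) by (simp add: power2_eq_square field_simps)
    show "Q (x / t) (t * y) =
       (a0 + a1 / t * x + a2 * t * y + a3 * (x * y))\<^sup>2
     + (b0 + b1 / t * x + b2 * t * y + b3 * (x * y))\<^sup>2
     + (c0 + c1 / t * x + c2 * t * y + c3 * (x * y))\<^sup>2
     + x * (e0 / s + e1 * s * y)\<^sup>2 + y * (f0 * s + f1 / s * x)\<^sup>2
     + k1\<^sup>2 * (x * y * (1 - x * y)) + k2\<^sup>2 * (1 - x * y)
     + k3\<^sup>2 * (x * y) + t * k4\<^sup>2 * (y * (1 - x * y))"
      unfolding Q weighted_squares_def prod.case xy 1 2 by (simp add: mult_ac)
  qed (use assms(2) in auto)
qed

section \<open>Quadratics with a zero on the region\<close>

lemma limit_nonneg_right: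
  fixes h :: "real \<Rightarrow> real"
  assumes "isCont h 0" "\<forall>\<^sub>F s in at_right 0. h s \<ge> 0"
  shows "h 0 \<ge> 0"
proof (rule tendsto_lowerbound)
  show "(h \<longlongrightarrow> h 0) (at_right 0)"
    using assms(1) unfolding isCont_def by (rule filterlim_mono[OF _ order_refl at_le]) simp
qed (use assms in auto)

lemma limit_nonpos_left:
  fixes h :: "real \<Rightarrow> real"
  assumes "isCont h 0" "\<forall>\<^sub>F s in at_left 0. h s \<le> 0"
  shows "h 0 \<le> 0"
proof (rule tendsto_upperbound)
  show "(h \<longlongrightarrow> h 0) (at_left 0)"
    using assms(1) unfolding isCont_def by (rule filterlim_mono[OF _ order_refl at_le]) simp
qed (use assms in auto)

text \<open>Replaces the first-order condition at a minimum: if a nonnegative function has the form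
  \<open>s * h s\<close> near 0, then its derivative \<open>h 0\<close> vanishes there.\<close>

lemma sign_change_imp_zero:
  fixes h :: "real \<Rightarrow> real"
  assumes "isCont h 0" "\<forall>\<^sub>F s in at 0. s * h s \<ge> 0"
  shows "h 0 = 0"
proof (rule antisym)
  have "\<forall>\<^sub>F s in at_left 0. s * h s \<ge> 0" "\<forall>\<^sub>F s in at_right 0. s * h s \<ge> 0"
    using assms(2) by (auto simp: eventually_at_split)
  moreover have "\<forall>\<^sub>F s in at_left 0. s < (0::real)" "\<forall>\<^sub>F s in at_right 0. s > (0::real)"
    by (auto simp: eventually_at_filter)
  ultimately have "\<forall>\<^sub>F s in at_left 0. h s \<le> 0 \<and> s < 0" "\<forall>\<^sub>F s in at_right 0. h s \<ge> 0 \<and> s > 0"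
    by (auto elim: eventually_elim2 simp: zero_le_mult_iff)
  then have "\<forall>\<^sub>F s in at_left 0. h s \<le> 0" "\<forall>\<^sub>F s in at_right 0. h s \<ge> 0"
    by (auto elim: eventually_mono)
  then show "h 0 \<le> 0" "h 0 \<ge> 0"
    using limit_nonpos_left limit_nonneg_right assms(1) by blast+
qed

text \<open>Stationarity along the hyperbola x y = 1 and the sign along the inward diagonal turn the
  linear part into a nonnegative multiple of 1 - x y plus a quadratic correction. The corrected form
  is then either positive semidefinite or one of the three saddles certified above.\<close>

lemma certified_tight_at_one:
  fixes l1 l2 \<alpha> \<beta> \<gamma> :: real
  assumes nn: "\<And>x y. x \<ge> 0 \<Longrightarrow> y \<ge> 0 \<Longrightarrow> x * y \<le> 1 \<Longrightarrow>
      l1 * (x - 1) + l2 * (y - 1)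
        + \<alpha> * (x - 1)\<^sup>2 + 2 * \<beta> * ((x - 1) * (y - 1)) + \<gamma> * (y - 1)\<^sup>2 \<ge> 0"
    and m: "m \<ge> 0"
  shows "certified (\<lambda>x y. l1 * (x - 1) + l2 * (y - 1)
        + \<alpha> * (x - 1)\<^sup>2 + 2 * \<beta> * ((x - 1) * (y - 1)) + \<gamma> * (y - 1)\<^sup>2 + m * (x * y))"
proof -
  \<comment> \<open>\<open>s * h s\<close> is the quadratic at the point (1 + s, 1 / (1 + s)) of the
    hyperbola.\<close>
  define h where "h s = l1 - l2 / (1 + s) + s * (\<alpha> - 2 * \<beta> / (1 + s) + \<gamma> / (1 + s)\<^sup>2)" for s
  have sh: "s * h s \<ge> 0" if "s > -1" for s
  proof -
    have y: "1 / (1 + s) - 1 = - (s / (1 + s))" using that by (simp add: field_simps)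
    have "0 \<le> l1 * s + l2 * (- (s / (1 + s))) + \<alpha> * s\<^sup>2
        + 2 * \<beta> * (s * (- (s / (1 + s)))) + \<gamma> * (- (s / (1 + s)))\<^sup>2"
      using nn[of "1 + s" "1 / (1 + s)"] that unfolding y by simp
    also have "\<dots> = s * h s"
      by (simp add: h_def power2_eq_square algebra_simps)
    finally show ?thesis .
  qed
  have "h 0 = 0"
  proof (rule sign_change_imp_zero)
    show "isCont h 0" unfolding h_def by (intro continuous_intros) auto
    have "\<forall>\<^sub>F s in at 0. s > (-1::real)"
      by (rule order_tendstoD(1)[OF tendsto_ident_at]) simp
    then show "\<forall>\<^sub>F s in at 0. s * h s \<ge> 0" by eventually_elim (rule sh)
  qed
  then have l: "l2 = l1" by (simp add: h_def)
  \<comment> \<open>The quadratic at (1 - s, 1 - s), divided by s; its limit gives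
    \<open>l1 \<le> 0\<close>.\<close>
  have "0 \<le> (\<lambda>s. - 2 * l1 + s * (\<alpha> + 2 * \<beta> + \<gamma>)) 0"
  proof (rule limit_nonneg_right)
    have "\<forall>\<^sub>F s in at_right 0. s < (1::real)"
      by (rule order_tendstoD(2)[OF tendsto_ident_at]) simp
    moreover have "\<forall>\<^sub>F s in at_right 0. s > (0::real)" by (auto simp: eventually_at_filter)
    ultimately show "\<forall>\<^sub>F s in at_right 0. 0 \<le> - 2 * l1 + s * (\<alpha> + 2 * \<beta> + \<gamma>)"
    proof eventually_elim
      case (elim s)
      have "0 \<le> s * (- 2 * l1 + s * (\<alpha> + 2 * \<beta> + \<gamma>))"
        using nn[of "1 - s" "1 - s"] elim l
        by (simp add: power2_eq_square algebra_simps mult_le_one)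
      then show ?case using elim by (simp add: zero_le_mult_iff)
    qed
  qed (intro continuous_intros)
  \<comment> \<open>From (x - 1) + (y - 1) = (x y - 1) - (x - 1) (y - 1): the linear part becomes
    \<open>\<mu> * (1 - x * y)\<close>, and \<open>B\<close> takes up the remaining product.\<close>
  define \<mu> B where "\<mu> = - l1" and "B = \<beta> + \<mu> / 2"
  have \<mu>: "\<mu> \<ge> 0" using \<open>0 \<le> (\<lambda>s. - 2 * l1 + s * (\<alpha> + 2 * \<beta> + \<gamma>)) 0\<close> by (simp add: \<mu>_def)
  have eq: "l1 * (x - 1) + l2 * (y - 1)
        + \<alpha> * (x - 1)\<^sup>2 + 2 * \<beta> * ((x - 1) * (y - 1)) + \<gamma> * (y - 1)\<^sup>2
      = \<alpha> * (x - 1)\<^sup>2 + 2 * B * ((x - 1) * (y - 1)) + \<gamma> * (y - 1)\<^sup>2 + \<mu> * (1 - x * y)" for x y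
    unfolding l B_def \<mu>_def by (simp add: algebra_simps)
  note nn' = nn[unfolded eq]
  \<comment> \<open>On the hyperbola the \<open>\<mu>\<close> term vanishes and 1 / t - 1 = - (t -
    1) / t, so a square factors out.\<close>
  have H0: "\<alpha> * t\<^sup>2 - 2 * B * t + \<gamma> \<ge> 0" if "t > 0" "t \<noteq> 1" for t
  proof -
    have "0 \<le> \<alpha> * (t - 1)\<^sup>2 + 2 * B * ((t - 1) * (1 / t - 1)) + \<gamma> * (1 / t - 1)\<^sup>2"
      using nn'[of t "1 / t"] that by simp
    also have "\<dots> = ((t - 1) / t)\<^sup>2 * (\<alpha> * t\<^sup>2 - 2 * B * t + \<gamma>)"
      using that by (simp add: power2_eq_square field_simps)
    finally show ?thesis using that by (simp add: zero_le_mult_iff)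
  qed
  have H: "\<alpha> * t\<^sup>2 - 2 * B * t + \<gamma> \<ge> 0" if "t > 0" for t
  proof (cases "t = 1")
    case True
    have "(\<lambda>s. \<alpha> * (1 + s)\<^sup>2 - 2 * B * (1 + s) + \<gamma>) 0 \<ge> 0"
      by (rule limit_nonneg_right, intro continuous_intros)
         (use H0 in \<open>auto simp: eventually_at_filter\<close>)
    with True show ?thesis by simp
  qed (use H0 that in auto)
  have "(\<lambda>t. \<alpha> * t\<^sup>2 - 2 * B * t + \<gamma>) 0 \<ge> 0"
    by (rule limit_nonneg_right, intro continuous_intros)
       (use H in \<open>auto simp: eventually_at_filter\<close>)
  then have \<gamma>: "\<gamma> \<ge> 0" by simp
  have H': "\<alpha> - 2 * B * t + \<gamma> * t\<^sup>2 \<ge> 0" if "t > 0" for t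
  proof -
    have "0 \<le> t\<^sup>2 * (\<alpha> * (1 / t)\<^sup>2 - 2 * B * (1 / t) + \<gamma>)" using H[of "1 / t"] that by simp
    also have "\<dots> = \<alpha> - 2 * B * t + \<gamma> * t\<^sup>2" using that by (simp add: power2_eq_square field_simps)
    finally show ?thesis .
  qed
  have "(\<lambda>t. \<alpha> - 2 * B * t + \<gamma> * t\<^sup>2) 0 \<ge> 0"
    by (rule limit_nonneg_right, intro continuous_intros)
       (use H' in \<open>auto simp: eventually_at_filter\<close>)
  then have \<alpha>: "\<alpha> \<ge> 0" by simp
  \<comment> \<open>Evaluate \<open>H\<close> at its vertex \<open>B / \<alpha>\<close>, or for
    \<open>\<alpha> = 0\<close> at the point where it takes the value -1.\<close>
  have pos: "B\<^sup>2 \<le> \<alpha> * \<gamma>" if B: "B > 0"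
  proof (cases "\<alpha> = 0")
    case True
    then show ?thesis using H[of "(\<gamma> + 1) / (2 * B)"] B \<gamma> by simp
  next
    case False
    with \<alpha> have "\<alpha> > 0" by simp
    then show ?thesis using H[of "B / \<alpha>"] B by (simp add: power2_eq_square field_simps)
  qed
  consider "B\<^sup>2 \<le> \<alpha> * \<gamma>" | "\<alpha> * \<gamma> < B\<^sup>2" "B < 0"
    using pos by (cases "B > 0"; cases "B = 0") (auto simp: \<alpha> \<gamma> not_le[symmetric])
  then show ?thesis
  proof cases
    case 1
    then show ?thesis unfolding eq using certified_convex_at[of \<alpha> \<gamma> B \<mu> m 1 1] \<alpha> \<gamma> \<mu> m by simp
  next
    case 2
    define b where "b = - B"
    have b: "b > 0" "\<alpha> * \<gamma> < b\<^sup>2" "B = - b" using 2 by (auto simp: b_def)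
    \<comment> \<open>The needed lower bound on \<open>\<mu>\<close> comes from one point of the
      axes: the origin, or \<open>(1 - b / \<alpha>, 0)\<close>, which lies in the region when
      \<open>b \<le> \<alpha>\<close>, or \<open>(0, 1 - b / \<gamma>)\<close> when
      \<open>b \<le> \<gamma>\<close>.\<close>
    consider "\<alpha> \<le> b" "\<gamma> \<le> b" | "b \<le> \<alpha>" | "b \<le> \<gamma>" by linarith
    then have "certified (\<lambda>x y. \<alpha> * (x - 1)\<^sup>2 - 2 * b * ((x - 1) * (y - 1)) + \<gamma> * (y - 1)\<^sup>2
      + \<mu> * (1 - x * y) + m * (x * y))"
    proof cases
      case 1
      have "\<mu> \<ge> 2 * b - \<alpha> - \<gamma>" using nn'[of 0 0] b(3) by simp
      then show ?thesis using certified_saddle_at_origin[of \<alpha> b \<gamma> \<mu> m] 1 \<alpha> \<gamma> b m by simp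
    next
      case 2
      then have a: "\<alpha> > 0" using b by simp
      have "0 \<le> \<alpha> * (b / \<alpha>)\<^sup>2 - 2 * b * (b / \<alpha>) + \<gamma> + \<mu>"
        using nn'[of "1 - b / \<alpha>" 0] a b(3) 2 by (simp add: algebra_simps)
      also have "\<dots> = \<gamma> + \<mu> - b\<^sup>2 / \<alpha>" using a by (simp add: power2_eq_square field_simps)
      finally show ?thesis
        using certified_saddle_on_x_axis[of b \<alpha> \<gamma> \<mu> m] 2 \<gamma> b m by simp
    next
      case 3
      then have a: "\<gamma> > 0" using b by simp
      have "0 \<le> \<gamma> * (b / \<gamma>)\<^sup>2 - 2 * b * (b / \<gamma>) + \<alpha> + \<mu>"
        using nn'[of 0 "1 - b / \<gamma>"] a b(3) 3 by (simp add: algebra_simps)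
      also have "\<dots> = \<alpha> + \<mu> - b\<^sup>2 / \<gamma>" using a by (simp add: power2_eq_square field_simps)
      finally show ?thesis
        using certified_saddle_on_y_axis[of b \<gamma> \<alpha> \<mu> m] 3 \<alpha> b m by simp
    qed
    then show ?thesis unfolding eq b(3) by (simp add: mult.assoc)
  qed
qed

text \<open>Every direction can be followed both ways from an interior zero, so the gradient
  vanishes and the quadratic form is positive semidefinite.\<close>

lemma certified_interior_zero:
  fixes l1 l2 \<alpha> \<beta> \<gamma> x0 y0 :: real
  assumes nn: "\<And>x y. x \<ge> 0 \<Longrightarrow> y \<ge> 0 \<Longrightarrow> x * y \<le> 1 \<Longrightarrow>
      l1 * (x - x0) + l2 * (y - y0)
        + \<alpha> * (x - x0)\<^sup>2 + 2 * \<beta> * ((x - x0) * (y - y0)) + \<gamma> * (y - y0)\<^sup>2 \<ge> 0"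
    and "x0 > 0" "y0 > 0" "x0 * y0 < 1" and m: "m \<ge> 0"
  shows "certified (\<lambda>x y. l1 * (x - x0) + l2 * (y - y0)
        + \<alpha> * (x - x0)\<^sup>2 + 2 * \<beta> * ((x - x0) * (y - y0)) + \<gamma> * (y - y0)\<^sup>2 + m * (x * y))"
proof -
  define D where "D u v = \<alpha> * u\<^sup>2 + 2 * \<beta> * (u * v) + \<gamma> * v\<^sup>2" for u v
  have ev: "\<forall>\<^sub>F s in at 0. s * (l1 * u + l2 * v + s * D u v) \<ge> 0" for u v
  proof -
    have "((\<lambda>s. x0 + s * u) \<longlongrightarrow> x0 + 0 * u) (at 0)" "((\<lambda>s. y0 + s * v) \<longlongrightarrow> y0 + 0 * v) (at 0)"
      "((\<lambda>s. (x0 + s * u) * (y0 + s * v)) \<longlongrightarrow> (x0 + 0 * u) * (y0 + 0 * v)) (at 0)"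
      by (intro tendsto_intros)+
    then have "\<forall>\<^sub>F s in at 0. x0 + s * u > 0" "\<forall>\<^sub>F s in at 0. y0 + s * v > 0"
      "\<forall>\<^sub>F s in at 0. (x0 + s * u) * (y0 + s * v) < 1"
      using assms(2-4) by (auto dest: order_tendstoD)
    then show ?thesis
    proof eventually_elim
      case (elim s)
      then show ?case using nn[of "x0 + s * u" "y0 + s * v"]
        by (simp add: D_def power2_eq_square algebra_simps)
    qed
  qed
  have l: "l1 * u + l2 * v = 0" for u v
    using sign_change_imp_zero[OF _ ev, of u v] by (simp add: continuous_intros)
  have l12: "l1 = 0" "l2 = 0" using l[of 1 0] l[of 0 1] by auto
  have D: "D u v \<ge> 0" for u v
  proof -
    have "\<forall>\<^sub>F s in at_right 0. s * (s * D u v) \<ge> 0"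
      using ev[of u v] by (simp add: l12 eventually_at_split)
    moreover have "\<forall>\<^sub>F s in at_right 0. s > (0::real)" by (auto simp: eventually_at_filter)
    ultimately have "\<forall>\<^sub>F s in at_right (0::real). D u v \<ge> 0"
      by eventually_elim (auto simp: zero_le_mult_iff)
    then show ?thesis by simp
  qed
  have \<alpha>: "\<alpha> \<ge> 0" and \<gamma>: "\<gamma> \<ge> 0" using D[of 1 0] D[of 0 1] by (auto simp: D_def)
  have "\<beta>\<^sup>2 \<le> \<alpha> * \<gamma>"
  proof (cases "\<alpha> = 0")
    case True
    have "\<beta> = 0"
    proof (rule ccontr)
      assume "\<beta> \<noteq> 0"
      \<comment> \<open>The chosen vector gives \<open>D\<close> the value -1.\<close>
      then show False using D[of "- (\<gamma> + 1) / (2 * \<beta>)" 1] True by (simp add: D_def)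
    qed
    then show ?thesis using True by simp
  next
    case False
    have "D (- \<beta>) \<alpha> = \<alpha> * (\<alpha> * \<gamma> - \<beta>\<^sup>2)" by (simp add: D_def power2_eq_square algebra_simps)
    then show ?thesis using D[of "- \<beta>" \<alpha>] \<alpha> False by (simp add: zero_le_mult_iff)
  qed
  then show ?thesis using certified_convex_at[of \<alpha> \<gamma> \<beta> 0 m x0 y0] \<alpha> \<gamma> m by (simp add: l12)
qed

section \<open>Reduction of a coercive quadratic to one with a zero\<close>

definition bivariate_quadratic ::
    "real \<Rightarrow> real \<Rightarrow> real \<Rightarrow> real \<Rightarrow> real \<Rightarrow> real \<Rightarrow> real \<Rightarrow> real \<Rightarrow> real" where
  "bivariate_quadratic a b c d e p x y =
     a * x\<^sup>2 + 2 * b * (x * y) + c * y\<^sup>2 + 2 * d * x + 2 * e * y + p"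

text \<open>The largest m with Q - m x y nonnegative on the region is the minimum of Q / (x y).
  Coercivity makes it attained at a point with positive coordinates, and \<open>m > 0\<close> allows
  the removed term to be restored with weight x y.\<close>

lemma certified_coercive:
  fixes a b c d e p \<epsilon> :: real
  defines "Q \<equiv> bivariate_quadratic a b c d e p"
  assumes lower: "\<And>x y. x \<ge> 0 \<Longrightarrow> y \<ge> 0 \<Longrightarrow> x * y \<le> 1 \<Longrightarrow> Q x y \<ge> \<epsilon> * (1 + x\<^sup>2 + y\<^sup>2)"
    and \<epsilon>: "\<epsilon> > 0"
  shows "certified Q"
proof -
  define M where "M = Q 1 1"
  have M: "M \<ge> 3 * \<epsilon>" using lower[of 1 1] by (simp add: M_def)
  then have M0: "M > 0" using \<epsilon> by simp
  \<comment> \<open>\<open>M\<close> is the ratio at (1, 1). Wherever Q \<le> M x y on the region,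
    \<epsilon> (1 + x^2 + y^2) \<le> M x y \<le> M, which bounds x y away from 0 and x, y from
    above. Hence \<open>K\<close> contains every candidate for the minimum.\<close>
  define K where "K = {z \<in> {0..M / \<epsilon> + 1} \<times> {0..M / \<epsilon> + 1}. \<epsilon> \<le> M * (fst z * snd z) \<and> fst z * snd z \<le> 1}"
  have "compact K"
  proof -
    have "K = ({0..M / \<epsilon> + 1} \<times> {0..M / \<epsilon> + 1}) \<inter> ({z. \<epsilon> \<le> M * (fst z * snd z)} \<inter> {z. fst z * snd z \<le> 1})"
      by (auto simp: K_def)
    moreover have "closed {z::real\<times>real. \<epsilon> \<le> M * (fst z * snd z)}" "closed {z::real\<times>real. fst z * snd z \<le> 1}"
      by (intro closed_Collect_le continuous_intros)+
    ultimately show ?thesis by (simp add: compact_Int_closed closed_Int compact_Times)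
  qed
  moreover have in_K: "(1, 1) \<in> K" using M \<epsilon> M0 by (simp add: K_def)
  moreover have "continuous_on K (\<lambda>z. Q (fst z) (snd z) / (fst z * snd z))"
    unfolding Q_def bivariate_quadratic_def
    by (intro continuous_intros) (use \<epsilon> in \<open>auto simp: K_def\<close>)
  ultimately obtain z0 where z0: "z0 \<in> K" and
    min: "\<And>z. z \<in> K \<Longrightarrow> Q (fst z0) (snd z0) / (fst z0 * snd z0) \<le> Q (fst z) (snd z) / (fst z * snd z)"
    using continuous_attains_inf[of K "\<lambda>z. Q (fst z) (snd z) / (fst z * snd z)"] by blast
  define x0 y0 m where "x0 = fst z0" and "y0 = snd z0" and "m = Q x0 y0 / (x0 * y0)"
  have "x0 \<ge> 0" "y0 \<ge> 0" "\<epsilon> \<le> M * (x0 * y0)" and le1: "x0 * y0 \<le> 1"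
    using z0 by (auto simp: K_def x0_def y0_def)
  then have x0: "x0 > 0" and y0: "y0 > 0" using \<epsilon> by (auto simp: less_le)
  have Q0: "Q x0 y0 > 0"
  proof -
    have "\<epsilon> * (1 + x0\<^sup>2 + y0\<^sup>2) > 0" using \<epsilon> by (intro mult_pos_pos add_pos_nonneg) auto
    then show ?thesis using lower[of x0 y0] x0 y0 le1 by simp
  qed
  then have m: "m > 0" using x0 y0 by (simp add: m_def)
  have mM: "m \<le> M" using min[OF in_K] by (simp add: m_def x0_def y0_def M_def)
  have nn: "Q x y - m * (x * y) \<ge> 0" if xy: "x \<ge> 0" "y \<ge> 0" "x * y \<le> 1" for x y
  proof (cases "Q x y \<le> M * (x * y)")
    case True
    have low: "\<epsilon> * (1 + x\<^sup>2 + y\<^sup>2) \<le> M * (x * y)" using lower[OF xy] True by simp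
    have "\<epsilon> * 1 \<le> \<epsilon> * (1 + x\<^sup>2 + y\<^sup>2)" using \<epsilon> by (intro mult_left_mono) auto
    with low have low1: "\<epsilon> \<le> M * (x * y)" by simp
    have "M * (x * y) \<le> M * 1" using M0 xy by (intro mult_left_mono) auto
    with low have "\<epsilon> * (1 + x\<^sup>2 + y\<^sup>2) \<le> M" by simp
    then have s: "1 + x\<^sup>2 + y\<^sup>2 \<le> M / \<epsilon>" using \<epsilon> by (simp add: field_simps)
    have "2 * x \<le> 1 + x\<^sup>2" "2 * y \<le> 1 + y\<^sup>2"
      using sum_squares_bound[of 1 x] sum_squares_bound[of 1 y] by auto
    then have "x \<le> M / \<epsilon> + 1" "y \<le> M / \<epsilon> + 1" using s xy
      by (smt (verit) zero_le_power2)+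
    then have "(x, y) \<in> K" using xy low1 by (simp add: K_def)
    from min[OF this] have "m \<le> Q x y / (x * y)" by (simp add: m_def x0_def y0_def)
    moreover have "x * y > 0" using low1 \<epsilon> M0 by (smt (verit) mult_nonneg_nonpos)
    ultimately show ?thesis by (simp add: field_simps)
  next
    case False
    have "m * (x * y) \<le> M * (x * y)" using mM xy by (intro mult_right_mono) auto
    then show ?thesis using False by simp
  qed
  \<comment> \<open>Taylor coefficients of Q - m x y at \<open>(x0, y0)\<close>, where its value is
    0.\<close>
  define l1 l2 b' where "l1 = 2 * a * x0 + 2 * b * y0 + 2 * d - m * y0"
    and "l2 = 2 * b * x0 + 2 * c * y0 + 2 * e - m * x0" and "b' = b - m / 2"
  have z: "Q x0 y0 = m * (x0 * y0)" using x0 y0 by (simp add: m_def)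
  have expand: "Q x y = l1 * (x - x0) + l2 * (y - y0)
      + a * (x - x0)\<^sup>2 + 2 * b' * ((x - x0) * (y - y0)) + c * (y - y0)\<^sup>2 + m * (x * y)" for x y
    using z unfolding Q_def bivariate_quadratic_def l1_def l2_def b'_def
    by (simp add: power2_eq_square algebra_simps)
  have nn': "l1 * (x - x0) + l2 * (y - y0)
      + a * (x - x0)\<^sup>2 + 2 * b' * ((x - x0) * (y - y0)) + c * (y - y0)\<^sup>2 \<ge> 0"
    if "x \<ge> 0" "y \<ge> 0" "x * y \<le> 1" for x y
    using nn[OF that] expand[of x y] by simp
  show ?thesis
  proof (cases "x0 * y0 < 1")
    case True
    have "Q = (\<lambda>x y. l1 * (x - x0) + l2 * (y - y0)
      + a * (x - x0)\<^sup>2 + 2 * b' * ((x - x0) * (y - y0)) + c * (y - y0)\<^sup>2 + m * (x * y))"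
      using expand by (intro ext)
    then show ?thesis
      using certified_interior_zero[of l1 x0 l2 y0 a b' c m] nn' x0 y0 True m by simp
  next
    case False
    with le1 have 1: "x0 * y0 = 1" by simp
    \<comment> \<open>Q - m x y in the coordinates X = x / x0 and Y = y / y0 = x0 y.\<close>
    define T where "T X Y = l1 * x0 * (X - 1) + l2 * y0 * (Y - 1)
      + a * x0\<^sup>2 * (X - 1)\<^sup>2 + 2 * b' * ((X - 1) * (Y - 1)) + c * y0\<^sup>2 * (Y - 1)\<^sup>2" for X Y
    have sc: "T X Y = l1 * (x0 * X - x0) + l2 * (y0 * Y - y0) + a * (x0 * X - x0)\<^sup>2
        + 2 * b' * ((x0 * X - x0) * (y0 * Y - y0)) + c * (y0 * Y - y0)\<^sup>2" for X Y
    proof -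
      have "(x0 * X - x0) * (y0 * Y - y0) = x0 * y0 * ((X - 1) * (Y - 1))"
        by (simp add: algebra_simps)
      then have P: "(x0 * X - x0) * (y0 * Y - y0) = (X - 1) * (Y - 1)" unfolding 1 by simp
      show ?thesis unfolding P T_def by (simp add: power2_eq_square algebra_simps)
    qed
    have "T X Y \<ge> 0" if "X \<ge> 0" "Y \<ge> 0" "X * Y \<le> 1" for X Y
    proof -
      have "x0 * X * (y0 * Y) = x0 * y0 * (X * Y)" by (simp only: mult_ac)
      then have "x0 * X * (y0 * Y) \<le> 1" by (simp only: 1 that mult_1)
      then show ?thesis unfolding sc using x0 y0 that by (intro nn') auto
    qed
    then have "certified (\<lambda>X Y. T X Y + m * (X * Y))"
      unfolding T_def using m by (intro certified_tight_at_one) auto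
    from certified_scale[OF this x0]
    have "certified (\<lambda>x y. T (x / x0) (x0 * y) + m * (x * y))" using x0 by simp
    moreover have "T (x / x0) (x0 * y) + m * (x * y) = Q x y" for x y
    proof -
      have y: "y0 * (x0 * y) = y" using 1 by (metis mult.assoc mult.commute mult_1)
      have x: "x0 * (x / x0) = x" using x0 by simp
      show ?thesis unfolding sc expand x y by simp
    qed
    ultimately show ?thesis by simp
  qed
qed

section \<open>Removing the perturbation\<close>

definition quadruple_box :: "real \<Rightarrow> quadruple set" where
  "quadruple_box M = {- M..M} \<times> {- M..M} \<times> {- M..M} \<times> {- M..M}"

definition weights_box :: "real \<Rightarrow> weights set" where
  "weights_box M = quadruple_box M \<times> quadruple_box M \<times> quadruple_box M
     \<times> ({- M..M} \<times> {- M..M}) \<times> ({- M..M} \<times> {- M..M}) \<times> quadruple_box M"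

lemma compact_weights_box: "compact (weights_box M)"
  unfolding weights_box_def quadruple_box_def by (intro compact_Times compact_Icc)

lemma bounds_of_square_le:
  fixes z M :: real
  assumes "z\<^sup>2 \<le> M" "M \<ge> 1"
  shows "- M \<le> z" "z \<le> M"
proof -
  have "M * 1 \<le> M * M" using assms by (intro mult_left_mono) auto
  then have "z\<^sup>2 \<le> M\<^sup>2" using assms unfolding power2_eq_square by linarith
  then have "\<bar>z\<bar> \<le> M" using assms abs_le_square_iff[of z M] by simp
  then show "- M \<le> z" "z \<le> M" by auto
qed

text \<open>The hypotheses bound a bilinear polynomial at the corners of the unit square. Its
  coefficients are signed sums of at most four corner values, so the factor 6 is generous.\<close>

lemma in_quadruple_box:
  fixes a0 a1 a2 a3 M :: real
  assumes "a0\<^sup>2 \<le> M" "(a0 + a1)\<^sup>2 \<le> M" "(a0 + a2)\<^sup>2 \<le> M" "(a0 + a1 + a2 + a3)\<^sup>2 \<le> M" "M \<ge> 1"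
  shows "(a0, a1, a2, a3) \<in> quadruple_box (6 * M)"
  using assms(1-4)[THEN bounds_of_square_le(1)[OF _ assms(5)]]
    assms(1-4)[THEN bounds_of_square_le(2)[OF _ assms(5)]]
  by (simp add: quadruple_box_def)

text \<open>All weights are nonnegative at the five points, so each term alone is at most
  \<open>M\<close>. The point (1, 1/2) controls \<open>k1\<close>, whose weight x y (1 - x y)
  vanishes at the corners.\<close>

lemma weights_bounded:
  assumes "weighted_squares w 0 0 \<le> M" "weighted_squares w 1 0 \<le> M" "weighted_squares w 0 1 \<le> M"
    "weighted_squares w 1 1 \<le> M" "weighted_squares w 1 (1/2) \<le> M" and M: "M \<ge> 1"
  shows "w \<in> weights_box (6 * M)"
proof -
  obtain a0 a1 a2 a3 b0 b1 b2 b3 c0 c1 c2 c3 e0 e1 f0 f1 k1 k2 k3 k4 where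
    w: "w = ((a0, a1, a2, a3), (b0, b1, b2, b3), (c0, c1, c2, c3),
       (e0, e1), (f0, f1), (k1, k2, k3, k4))"
    by (rule weights_cases)
  have 1: "a0\<^sup>2 + b0\<^sup>2 + c0\<^sup>2 + k2\<^sup>2 \<le> M"
    using assms(1) by (simp add: w weighted_squares_def)
  have 2: "(a0 + a1)\<^sup>2 + (b0 + b1)\<^sup>2 + (c0 + c1)\<^sup>2 + e0\<^sup>2 + k2\<^sup>2 \<le> M"
    using assms(2) by (simp add: w weighted_squares_def)
  have 3: "(a0 + a2)\<^sup>2 + (b0 + b2)\<^sup>2 + (c0 + c2)\<^sup>2 + f0\<^sup>2 + k2\<^sup>2 + k4\<^sup>2 \<le> M"
    using assms(3) by (simp add: w weighted_squares_def)
  have 4: "(a0 + a1 + a2 + a3)\<^sup>2 + (b0 + b1 + b2 + b3)\<^sup>2 + (c0 + c1 + c2 + c3)\<^sup>2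
      + (e0 + e1)\<^sup>2 + (f0 + f1)\<^sup>2 + k3\<^sup>2 \<le> M"
    using assms(4) by (simp add: w weighted_squares_def)
  have "k1\<^sup>2 / 4 \<le> weighted_squares w 1 (1/2)"
    by (simp add: w weighted_squares_def add_nonneg_nonneg)
  then have 5: "(k1 / 2)\<^sup>2 \<le> M" using assms(5) by (simp add: power_divide)
  note nonneg =
    zero_le_power2[of a0] zero_le_power2[of "a0 + a1"] zero_le_power2[of "a0 + a2"] zero_le_power2[of "a0 + a1 + a2 + a3"]
    zero_le_power2[of b0] zero_le_power2[of "b0 + b1"] zero_le_power2[of "b0 + b2"] zero_le_power2[of "b0 + b1 + b2 + b3"]
    zero_le_power2[of c0] zero_le_power2[of "c0 + c1"] zero_le_power2[of "c0 + c2"] zero_le_power2[of "c0 + c1 + c2 + c3"]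
    zero_le_power2[of e0] zero_le_power2[of "e0 + e1"] zero_le_power2[of f0] zero_le_power2[of "f0 + f1"]
    zero_le_power2[of k2] zero_le_power2[of k3] zero_le_power2[of k4]
  have "(a0, a1, a2, a3) \<in> quadruple_box (6 * M)" "(b0, b1, b2, b3) \<in> quadruple_box (6 * M)"
    "(c0, c1, c2, c3) \<in> quadruple_box (6 * M)"
    by (rule in_quadruple_box[OF _ _ _ _ M]; use 1 2 3 4 nonneg in linarith)+
  moreover have sq: "e0\<^sup>2 \<le> M" "(e0 + e1)\<^sup>2 \<le> M" "f0\<^sup>2 \<le> M" "(f0 + f1)\<^sup>2 \<le> M"
      "k2\<^sup>2 \<le> M" "k3\<^sup>2 \<le> M" "k4\<^sup>2 \<le> M"
    using 1 2 3 4 nonneg by linarith+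
  moreover have "e0 \<in> {- (6 * M)..6 * M}" "e1 \<in> {- (6 * M)..6 * M}"
    "f0 \<in> {- (6 * M)..6 * M}" "f1 \<in> {- (6 * M)..6 * M}"
    "(k1, k2, k3, k4) \<in> quadruple_box (6 * M)"
    using sq[THEN bounds_of_square_le(1)[OF _ M]] sq[THEN bounds_of_square_le(2)[OF _ M]]
      bounds_of_square_le[OF 5 M] M
    by (simp_all add: quadruple_box_def)
  ultimately show ?thesis by (simp add: w weights_box_def)
qed

text \<open>Convergence at five points already confines all certificates to one compact box. A
  convergent subsequence yields a certificate of the limit, since \<open>weighted_squares\<close> is
  continuous in its coefficients.\<close>

lemma certified_limit:
  assumes "\<And>n. certified (f n)" and lim: "\<And>x y. (\<lambda>n. f n x y) \<longlonglongrightarrow> q x y"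
  shows "certified q"
proof -
  obtain w where w: "\<And>n x y. f n x y = weighted_squares (w n) x y"
    using assms(1) unfolding certified_def by metis
  have "\<exists>B. \<forall>n. f n x y \<le> B" for x y
    using convergent_imp_Bseq[OF convergentI[OF lim]] unfolding Bseq_def
    by (metis abs_le_D1 real_norm_def)
  then obtain B where B: "\<And>x y n. f n x y \<le> B x y" by metis
  define M where "M = Max {1, B 0 0, B 1 0, B 0 1, B 1 1, B 1 (1/2)}"
  have M: "1 \<le> M" "B 0 0 \<le> M" "B 1 0 \<le> M" "B 0 1 \<le> M" "B 1 1 \<le> M" "B 1 (1/2) \<le> M"
    by (simp_all add: M_def)
  have "w n \<in> weights_box (6 * M)" for n
    by (rule weights_bounded; use M B w in \<open>metis order_trans\<close>)
  then obtain l \<rho> where \<rho>: "strict_mono \<rho>" "(w \<circ> \<rho>) \<longlonglongrightarrow> l"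
    using compact_weights_box[of "6 * M"] unfolding compact_def by metis
  have "q x y = weighted_squares l x y" for x y
  proof (rule LIMSEQ_unique)
    show "(\<lambda>n. f (\<rho> n) x y) \<longlonglongrightarrow> q x y"
      using LIMSEQ_subseq_LIMSEQ[OF lim \<rho>(1)] by (simp add: o_def)
    show "(\<lambda>n. f (\<rho> n) x y) \<longlonglongrightarrow> weighted_squares l x y"
      using \<rho>(2) unfolding w weighted_squares_def case_prod_beta o_def
      by (intro tendsto_intros)
  qed
  then show ?thesis unfolding certified_def by blast
qed

section \<open>From weighted squares to octics\<close>

lemma eval3_simps [simp]:
  "eval3 (f + g) y = eval3 f y + eval3 g y"
  "eval3 (f * g) y = eval3 f y * eval3 g y"
  "eval3 (f - g) y = eval3 f y - eval3 g y"
  "eval3 (f ^ n) y = eval3 f y ^ n"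
  "eval3 0 y = 0" "eval3 (numeral k) y = numeral k"
  "eval3 (Const c) y = c"
  "eval3 Y1 y = y $ 1" "eval3 Y2 y = y $ 2" "eval3 Y3 y = y $ 3"
  by (simp_all add: eval3_def Const_def Y1_def Y2_def Y3_def)

lemma eval3_sum_list: "eval3 (\<Sum>g\<leftarrow>gs. g\<^sup>2) y = (\<Sum>g\<leftarrow>gs. (eval3 g y)\<^sup>2)"
  by (induction gs) simp_all

text \<open>In the iterated ring the outer variables are evaluated only at constant polynomials;
  these still form an infinite set.\<close>

lemma poly_eq_0_on_infinite:
  fixes p :: "'a::idom poly"
  assumes "infinite (range h)" "\<And>x. poly p (h x) = 0"
  shows "p = 0"
proof (rule ccontr)
  assume "p \<noteq> 0"
  then have "finite {x. poly p x = 0}" by (rule poly_roots_finite)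
  moreover have "range h \<subseteq> {x. poly p x = 0}" using assms(2) by auto
  ultimately show False using assms(1) finite_subset by blast
qed

lemma eval3_eq_0:
  assumes "\<And>y. eval3 f y = 0"
  shows "f = 0"
proof -
  have "poly (poly (poly f [:[:c:]:]) [:b:]) a = 0" for a b c :: real
    using assms[of "vector [a, b, c]"] by (simp add: eval3_def)
  then have "poly (poly f [:[:c:]:]) [:b:] = 0" for b c :: real
    using poly_all_0_iff_0 by blast
  then have "poly f [:[:c:]:] = 0" for c :: real
    using poly_eq_0_on_infinite[of "\<lambda>b::real. [:b:]"] by (simp add: finite_image_iff inj_def infinite_UNIV_char_0)
  then show ?thesis
    using poly_eq_0_on_infinite[of "\<lambda>c::real. [:[:c:]:]"] by (simp add: finite_image_iff inj_def infinite_UNIV_char_0)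
qed

text \<open>Multiplying the difference by the nonzero polynomial Y3 (Y1^2 + Y2^2) makes it vanish
  everywhere, and the ring is a domain. Identities may thus be checked where the quotients defining
  (x, y) make sense.\<close>

lemma poly3_eqI:
  assumes "\<And>y. y $ 3 \<noteq> 0 \<Longrightarrow> (y $ 1)\<^sup>2 + (y $ 2)\<^sup>2 \<noteq> 0 \<Longrightarrow> eval3 f y = eval3 g y"
  shows "f = g"
proof -
  define h where "h = Y3 * (Y1\<^sup>2 + Y2\<^sup>2)"
  have "(f - g) * h = 0"
    by (rule eval3_eq_0) (use assms in \<open>auto simp: h_def\<close>)
  moreover have "h \<noteq> 0"
  proof
    assume "h = 0"
    then have "eval3 h (vector [1, 1, 1]) = 0" by simp
    then show False by (simp add: h_def)
  qed
  ultimately show ?thesis by simp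
qed

lemma symmetric_matrix_entries:
  fixes R :: "real^2^2"
  assumes "transpose R = R"
  shows "R $ 2 $ 1 = R $ 1 $ 2"
proof -
  have "transpose R $ 2 $ 1 = R $ 1 $ 2" by (simp add: transpose_def)
  then show ?thesis by (simp add: assms)
qed

lemma quad_vector:
  assumes "transpose R = R"
  shows "quad R r p (vector [u, v]) =
    R $ 1 $ 1 * u\<^sup>2 + 2 * R $ 1 $ 2 * (u * v) + R $ 2 $ 2 * v\<^sup>2 + 2 * r $ 1 * u + 2 * r $ 2 * v + p"
  using symmetric_matrix_entries[OF assms]
  by (simp add: quad_def inner_vec_def matrix_vector_mult_def sum_2 power2_eq_square algebra_simps)

lemma eval3_octic:
  fixes y :: "real^3"
  assumes "transpose R = R" "y $ 3 \<noteq> 0" "(y $ 1)\<^sup>2 + (y $ 2)\<^sup>2 \<noteq> 0"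
  shows "eval3 (octic R r p) y = ((y $ 3)\<^sup>2 * ((y $ 1)\<^sup>2 + (y $ 2)\<^sup>2))\<^sup>2 *
    quad R r p (vector [(y $ 1)\<^sup>2 / (y $ 3)\<^sup>2, (y $ 3)\<^sup>2 / ((y $ 1)\<^sup>2 + (y $ 2)\<^sup>2)])"
proof -
  define s where "s = (y $ 1)\<^sup>2 + (y $ 2)\<^sup>2"
  define A B C where "A = (y $ 1)\<^sup>2 * s" and "B = (y $ 3)\<^sup>2 * s" and "C = (y $ 3)^4"
  define u v where "u = (y $ 1)\<^sup>2 / (y $ 3)\<^sup>2" and "v = (y $ 3)\<^sup>2 / s"
  have s0: "s \<noteq> 0" using assms(3) by (simp add: s_def)
  have uv: "A = B * u" "C = B * v"
    using assms(2) s0 by (simp_all add: A_def B_def C_def u_def v_def power2_eq_square power4_eq_xxxx)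
  have "eval3 (octic R r p) y = R $ 1 $ 1 * A\<^sup>2 + 2 * R $ 1 $ 2 * (A * C) + R $ 2 $ 2 * C\<^sup>2
      + 2 * r $ 1 * (A * B) + 2 * r $ 2 * (B * C) + p * B\<^sup>2"
    by (simp add: octic_def sum_3 ABC_def hom_matrix_def A_def B_def C_def s_def[symmetric])
       (simp add: power2_eq_square algebra_simps)
  also have "\<dots> = B\<^sup>2 * quad R r p (vector [u, v])"
    unfolding uv quad_vector[OF assms(1)] by (simp add: power2_eq_square algebra_simps)
  finally show ?thesis by (simp add: B_def u_def v_def s_def)
qed

text \<open>With s = y1^2 + y2^2 one has u = y1^2 / y3^2, v = y3^2 / s, u v = y1^2 / s and 1 - u v =
  y2^2 / s. An odd power of 1 / s is rewritten as s / s^2, and the factor s = y1^2 + y2^2 splits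
  that term into two squares; \<open>B^2\<close> clears the denominators.\<close>

lemma sos3_if_certified:
  assumes sym: "transpose R = R" and "certified (\<lambda>u v. quad R r p (vector [u, v]))"
  shows "sos3 (octic R r p)"
proof -
  obtain w where w: "\<And>u v. quad R r p (vector [u, v]) = weighted_squares w u v"
    using assms(2) unfolding certified_def by blast
  obtain a0 a1 a2 a3 b0 b1 b2 b3 c0 c1 c2 c3 e0 e1 f0 f1 k1 k2 k3 k4 where
    "w = ((a0, a1, a2, a3), (b0, b1, b2, b3), (c0, c1, c2, c3),
       (e0, e1), (f0, f1), (k1, k2, k3, k4))"
    by (rule weights_cases)
  note q = w[unfolded this]
  define L where "L a b c d = Const a * (Y3\<^sup>2 * (Y1\<^sup>2 + Y2\<^sup>2)) + Const b * (Y1\<^sup>2 * (Y1\<^sup>2 + Y2\<^sup>2))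
    + Const c * Y3 ^ 4 + Const d * (Y1\<^sup>2 * Y3\<^sup>2)" for a b c d
  define gs where "gs = [L a0 a1 a2 a3, L b0 b1 b2 b3, L c0 c1 c2 c3,
    Y1 * Y3 * (Const e0 * (Y1\<^sup>2 + Y2\<^sup>2) + Const e1 * Y3\<^sup>2),
    Y1 * Y3 * (Const f0 * Y3\<^sup>2 + Const f1 * Y1\<^sup>2), Y2 * Y3 * (Const f0 * Y3\<^sup>2 + Const f1 * Y1\<^sup>2),
    Const k1 * (Y1 * Y2 * Y3\<^sup>2),
    Const k2 * (Y1 * Y2 * Y3\<^sup>2), Const k2 * (Y2\<^sup>2 * Y3\<^sup>2),
    Const k3 * (Y1\<^sup>2 * Y3\<^sup>2), Const k3 * (Y1 * Y2 * Y3\<^sup>2),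
    Const k4 * (Y2 * Y3 ^ 3)]"
  have "octic R r p = (\<Sum>g\<leftarrow>gs. g\<^sup>2)"
  proof (rule poly3_eqI)
    fix y :: "real^3"
    assume y: "y $ 3 \<noteq> 0" "(y $ 1)\<^sup>2 + (y $ 2)\<^sup>2 \<noteq> 0"
    define s z where "s = (y $ 1)\<^sup>2 + (y $ 2)\<^sup>2" and "z = (y $ 3)\<^sup>2"
    define u v B where "u = (y $ 1)\<^sup>2 / z" and "v = z / s" and "B = z * s"
    have nz: "s \<noteq> 0" "z \<noteq> 0" using y by (simp_all add: s_def z_def)
    \<comment> \<open>Expressing \<open>B\<close> and the squares of the coordinates by
      \<open>u\<close>, \<open>v\<close>, \<open>s\<close> turns each term into a polynomial
      identity.\<close>
    have B: "B = v * s * s" using nz by (simp add: B_def v_def)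
    have y1: "(y $ 1)\<^sup>2 = u * v * s" and y3: "(y $ 3)\<^sup>2 = v * s"
      using nz by (simp_all add: u_def v_def z_def)
    have y2: "(y $ 2)\<^sup>2 = s * (1 - u * v)" using y1 by (simp add: s_def algebra_simps)
    have y4: "(y $ 3) ^ 4 = (v * s)\<^sup>2"
      unfolding y3[symmetric] by simp
    have L: "eval3 (L a b c d) y = B * (a + b * u + c * v + d * (u * v))" for a b c d
      unfolding L_def B eval3_simps y4 y1 y2 y3 by (simp add: power2_eq_square algebra_simps)
    have L2: "(eval3 (L a b c d) y)\<^sup>2 = B\<^sup>2 * (a + b * u + c * v + d * (u * v))\<^sup>2" for a b c d
      unfolding L by (rule power_mult_distrib)
    have E: "(eval3 (Y1 * Y3 * (Const e0 * (Y1\<^sup>2 + Y2\<^sup>2) + Const e1 * Y3\<^sup>2)) y)\<^sup>2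
        = B\<^sup>2 * (u * (e0 + e1 * v)\<^sup>2)"
      unfolding eval3_simps power_mult_distrib y1 y2 y3 B
      by (simp add: power2_eq_square algebra_simps)
    have F: "(eval3 (Y1 * Y3 * (Const f0 * Y3\<^sup>2 + Const f1 * Y1\<^sup>2)) y)\<^sup>2
        + (eval3 (Y2 * Y3 * (Const f0 * Y3\<^sup>2 + Const f1 * Y1\<^sup>2)) y)\<^sup>2 = B\<^sup>2 * (v * (f0 + f1 * u)\<^sup>2)"
      unfolding eval3_simps power_mult_distrib y1 y2 y3 B
      by (simp add: power2_eq_square algebra_simps)
    have K1: "(eval3 (Const k1 * (Y1 * Y2 * Y3\<^sup>2)) y)\<^sup>2 = B\<^sup>2 * (k1\<^sup>2 * (u * v * (1 - u * v)))"
      unfolding eval3_simps power_mult_distrib y1 y2 y3 B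
      by (simp add: power2_eq_square algebra_simps)
    have K2: "(eval3 (Const k2 * (Y1 * Y2 * Y3\<^sup>2)) y)\<^sup>2 + (eval3 (Const k2 * (Y2\<^sup>2 * Y3\<^sup>2)) y)\<^sup>2
        = B\<^sup>2 * (k2\<^sup>2 * (1 - u * v))"
      unfolding eval3_simps power_mult_distrib y1 y2 y3 B
      by (simp add: power2_eq_square algebra_simps)
    have K3: "(eval3 (Const k3 * (Y1\<^sup>2 * Y3\<^sup>2)) y)\<^sup>2 + (eval3 (Const k3 * (Y1 * Y2 * Y3\<^sup>2)) y)\<^sup>2
        = B\<^sup>2 * (k3\<^sup>2 * (u * v))"
      unfolding eval3_simps power_mult_distrib y1 y2 y3 B
      by (simp add: power2_eq_square algebra_simps)
    have "((y $ 3) ^ 3)\<^sup>2 = (v * s) ^ 3" unfolding y3[symmetric] by (simp flip: power_mult)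
    then have K4: "(eval3 (Const k4 * (Y2 * Y3 ^ 3)) y)\<^sup>2 = B\<^sup>2 * (k4\<^sup>2 * (v * (1 - u * v)))"
      unfolding eval3_simps power_mult_distrib y2 B
      by (simp add: power2_eq_square power3_eq_cube algebra_simps)
    have "eval3 (\<Sum>g\<leftarrow>gs. g\<^sup>2) y = B\<^sup>2 * quad R r p (vector [u, v])"
      unfolding q weighted_squares_def prod.case distrib_left L2[symmetric] E[symmetric] F[symmetric]
        K1[symmetric] K2[symmetric] K3[symmetric] K4[symmetric] eval3_sum_list gs_def
      by (simp only: list.map sum_list.Cons sum_list.Nil add.assoc add_0_right)
    also have "\<dots> = eval3 (octic R r p) y"
      using eval3_octic[OF sym y] by (simp add: B_def u_def v_def s_def z_def)
    finally show "eval3 (octic R r p) y = eval3 (\<Sum>g\<leftarrow>gs. g\<^sup>2) y" by simp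
  qed
  then show ?thesis unfolding sos3_def by blast
qed

lemma nonneg_on_F_if_octic_nonneg:
  assumes sym: "transpose R = R" and "nonneg3 (octic R r p)" and "x \<in> F"
  shows "quad R r p x \<ge> 0"
proof -
  have pos: "quad R r p (vector [u, v]) \<ge> 0" if "u \<ge> 0" "v > 0" "u * v \<le> 1" for u v
  proof -
    have uv: "1 / v - u \<ge> 0" using that by (simp add: field_simps)
    \<comment> \<open>Normalizing y3 = 1 leaves y1^2 = u and y1^2 + y2^2 = 1 / v.\<close>
    define y :: "real^3" where "y = vector [sqrt u, sqrt (1 / v - u), 1]"
    have s: "(y $ 1)\<^sup>2 + (y $ 2)\<^sup>2 = 1 / v" and y: "(y $ 1)\<^sup>2 = u" "y $ 3 = 1"
      using that uv by (simp_all add: y_def)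
    have nz: "y $ 3 \<noteq> 0" "(y $ 1)\<^sup>2 + (y $ 2)\<^sup>2 \<noteq> 0" using that(2) by (simp_all add: s y(2))
    have "0 \<le> eval3 (octic R r p) y" using assms(2) by (simp add: nonneg3_def)
    also have "\<dots> = (1 / v)\<^sup>2 * quad R r p (vector [u, v])"
      unfolding eval3_octic[OF sym nz] s by (simp add: y)
    finally show ?thesis using that(2) by (simp add: zero_le_mult_iff)
  qed
  define u v where "u = x $ 1" and "v = x $ 2"
  have x: "x = vector [u, v]" by (simp add: vec_eq_iff forall_2 u_def v_def)
  have uv: "u \<ge> 0" "v \<ge> 0" "u * v \<le> 1" using assms(3) by (auto simp: F_def u_def v_def)
  show ?thesis
  proof (cases "v = 0")
    case True
    \<comment> \<open>Points with v = 0 are not in the image of the parametrization; they are limits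
      of \<open>(u, t)\<close> with t > 0 and u t < 1.\<close>
    have "(\<lambda>t. quad R r p (vector [u, t])) 0 \<ge> 0"
    proof (rule limit_nonneg_right)
      show "isCont (\<lambda>t. quad R r p (vector [u, t])) 0"
        unfolding quad_vector[OF sym] by (intro continuous_intros)
      have "((\<lambda>t. u * t) \<longlongrightarrow> u * 0) (at_right 0)" by (intro tendsto_intros)
      then have "\<forall>\<^sub>F t in at_right 0. u * t < 1" by (rule order_tendstoD) simp
      moreover have "\<forall>\<^sub>F t in at_right 0. t > (0::real)" by (auto simp: eventually_at_filter)
      ultimately show "\<forall>\<^sub>F t in at_right 0. 0 \<le> quad R r p (vector [u, t])"
        by eventually_elim (use pos uv in auto)
    qed
    then show ?thesis by (simp add: x True)
  qed (use pos uv x in auto)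
qed

text \<open>Adding \<open>\<epsilon> n * (1 + u^2 + v^2)\<close> gives the coercive case, and
  \<open>certified_limit\<close> lets the perturbation tend to 0.\<close>

lemma certified_if_nonneg_on_F:
  assumes sym: "transpose R = R" and nn: "\<And>x. x \<in> F \<Longrightarrow> quad R r p x \<ge> 0"
  shows "certified (\<lambda>u v. quad R r p (vector [u, v]))"
proof -
  define \<epsilon> where "\<epsilon> n = inverse (real (Suc n))" for n
  define f where "f n = bivariate_quadratic (R $ 1 $ 1 + \<epsilon> n) (R $ 1 $ 2) (R $ 2 $ 2 + \<epsilon> n)
    (r $ 1) (r $ 2) (p + \<epsilon> n)" for n
  have f: "f n u v = quad R r p (vector [u, v]) + \<epsilon> n * (1 + u\<^sup>2 + v\<^sup>2)" for n u v
    by (simp add: f_def bivariate_quadratic_def quad_vector[OF sym] algebra_simps)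
  show ?thesis
  proof (rule certified_limit)
    fix n
    have "\<epsilon> n > 0" by (simp add: \<epsilon>_def)
    have "f n u v \<ge> \<epsilon> n * (1 + u\<^sup>2 + v\<^sup>2)" if "u \<ge> 0" "v \<ge> 0" "u * v \<le> 1" for u v
      using nn[of "vector [u, v]"] that by (simp add: f F_def)
    then show "certified (f n)"
      unfolding f_def by (rule certified_coercive[OF _ \<open>\<epsilon> n > 0\<close>])
  next
    fix u v
    have "(\<lambda>n. f n u v) \<longlonglongrightarrow> quad R r p (vector [u, v]) + 0 * (1 + u\<^sup>2 + v\<^sup>2)"
      unfolding f \<epsilon>_def by (intro tendsto_intros LIMSEQ_inverse_real_of_nat)
    then show "(\<lambda>n. f n u v) \<longlonglongrightarrow> quad R r p (vector [u, v])" by simp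
  qed
qed

lemma sos3_imp_nonneg3: "sos3 f \<Longrightarrow> nonneg3 f"
  by (auto simp: sos3_def nonneg3_def eval3_sum_list intro!: sum_list_nonneg)

theorem theorem3p2:
  shows "(\<forall>(R::real^2^2) (r::real^2) (p::real). transpose R = R \<longrightarrow>
            spans_extreme_ray (nonneg_cone F) (quad R r p) \<longrightarrow> sos3 (octic R r p))
       \<and> nonneg_octics = sos_octics
       \<and> (\<forall>(R::real^2^2) (r::real^2) (p::real). transpose R = R \<longrightarrow>
            (nonneg3 (octic R r p) \<longleftrightarrow> sos3 (octic R r p)))"
proof -
  have sos: "sos3 (octic R r p)" if "transpose R = R" "\<And>x. x \<in> F \<Longrightarrow> quad R r p x \<ge> 0" for R r p
    using that by (intro sos3_if_certified certified_if_nonneg_on_F)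
  have iff: "nonneg3 (octic R r p) \<longleftrightarrow> sos3 (octic R r p)" if "transpose R = R" for R r p
  proof
    assume "nonneg3 (octic R r p)"
    then show "sos3 (octic R r p)" by (intro sos that nonneg_on_F_if_octic_nonneg)
  qed (rule sos3_imp_nonneg3)
  have "sos3 (octic R r p)"
    if "transpose R = R" "spans_extreme_ray (nonneg_cone F) (quad R r p)" for R r p
  proof (rule sos[OF that(1)])
    fix x
    assume "x \<in> F"
    moreover have "quad R r p \<in> nonneg_cone F" using that(2) by (simp add: spans_extreme_ray_def)
    ultimately show "quad R r p x \<ge> 0" by (auto simp: nonneg_cone_def)
  qed
  moreover have "nonneg_octics = sos_octics"
    unfolding nonneg_octics_def sos_octics_def by (metis iff)
  ultimately show ?thesis using iff by simp
qed

end
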